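(* Let $G$ be a finite connected graph with at least two vertices, let $d$ be the maximum valence of a vertex in $G$, and let $\lambda_2$ be the algebraic connectivity of $G$. Then \[ \operatorname{gon}(G)\ \geq\ \frac{|V(G)|}{2\lambda_2}\left[ -(7\lambda_2+9d)+3\sqrt{9\lambda_2^2+14d\lambda_2+9d^2}\,\right]. \]
   Context: Graphs are finite and may have multiple edges; $\varepsilon(v,w)$ is the number of edges between distinct vertices $v,w$. Loops, if present, play no role in chip-firing or in the Laplacian. A divisor on $G$ is a formal $\mathbb{Z}$-linear combination $D=\sum_v D(v)\,v$ of vertices; its degree is $\sum_v D(v)$; it is effective if $D(v)\ge 0$ for all $v$. Firing a vertex $v$ replaces $D$ by $D'$ with $D'(v)=D(v)-\sum_{w\ne v}\varepsilon(v,w)$ and $D'(w)=D(w)+\varepsilon(w,v)$ for $w\neq v$. Two divisors are equivalent if they differ by an integer combination of firing moves. A divisor $D$ has positive rank if for every vertex $v$ the divisor $D-v$ is equivalent to an effective divisor. The gonality $\operatorname{gon}(G)$ is the smallest degree of a divisor on $G$ of positive rank. The algebraic connectivity $\lambda_2$ is the second smallest eigenvalue (counted with multiplicity) of the positive semidefinite graph Laplacian, i.e. the matrix with diagonal entries $\sum_{w\neq v}\varepsilon(v,w)$ and off-diagonal entries $-\varepsilon(v,w)$.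
   Formalization: The graph with two vertices joined by a single edge (and no loops) is excluded, since the bound fails there: gonality is 1 but the right-hand side is (3√73 − 23)/2 > 1; a loop counts two towards the valence. *)

theory Defs
  imports "HOL-Analysis.Analysis" "HOL-Computational_Algebra.Computational_Algebra" "HOL-Library.Uprod"
begin

text \<open>A finite multigraph whose vertex set is the whole finite type \<open>'v\<close> is the multiset of its
  edges, each an unordered pair of endpoints. A loop at \<open>v\<close> is an occurrence of \<open>Upair v v\<close>.\<close>

type_synonym 'v multigraph = "'v uprod multiset"

definition edge_mult :: "'v multigraph \<Rightarrow> 'v \<Rightarrow> 'v \<Rightarrow> nat" where
  "edge_mult G v w = count G (Upair v w)"

definition connected_multigraph :: "'v multigraph \<Rightarrow> bool" where
  "connected_multigraph G \<longleftrightarrow> (\<forall>v w. (v, w) \<in> {(x, y). Upair x y \<in># G}\<^sup>*)"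

text \<open>As usual, a loop contributes two to the valence of its vertex.\<close>

definition valence :: "('v::finite) multigraph \<Rightarrow> 'v \<Rightarrow> nat" where
  "valence G v = (\<Sum>w\<in>UNIV - {v}. edge_mult G v w) + 2 * edge_mult G v v"

definition max_valence :: "('v::finite) multigraph \<Rightarrow> nat" where
  "max_valence G = Max (range (valence G))"

type_synonym 'v divisor = "'v \<Rightarrow> int"

definition divisor_degree :: "('v::finite) divisor \<Rightarrow> int" where
  "divisor_degree D = (\<Sum>v\<in>UNIV. D v)"

definition effective :: "'v divisor \<Rightarrow> bool" where
  "effective D \<longleftrightarrow> (\<forall>v. D v \<ge> 0)"

text \<open>\<open>firing_move G v\<close> is the divisor by which firing \<open>v\<close> changes any given divisor.\<close>

definition firing_move :: "('v::finite) multigraph \<Rightarrow> 'v \<Rightarrow> 'v divisor" where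
  "firing_move G v = (\<lambda>w. if w = v then - (\<Sum>u\<in>UNIV - {v}. int (edge_mult G v u))
                          else int (edge_mult G w v))"

definition divisor_equiv :: "('v::finite) multigraph \<Rightarrow> 'v divisor \<Rightarrow> 'v divisor \<Rightarrow> bool" where
  "divisor_equiv G D D' \<longleftrightarrow>
     (\<exists>f :: 'v \<Rightarrow> int. \<forall>w. D' w = D w + (\<Sum>v\<in>UNIV. f v * firing_move G v w))"

definition positive_rank :: "('v::finite) multigraph \<Rightarrow> 'v divisor \<Rightarrow> bool" where
  "positive_rank G D \<longleftrightarrow>
     (\<forall>v. \<exists>E. effective E \<and> divisor_equiv G (\<lambda>w. D w - (if w = v then 1 else 0)) E)"

definition gonality :: "('v::finite) multigraph \<Rightarrow> int" where
  "gonality G = (LEAST k. \<exists>D. positive_rank G D \<and> divisor_degree D = k)"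

definition laplacian :: "('v::finite) multigraph \<Rightarrow> real ^ 'v ^ 'v" where
  "laplacian G = (\<chi> v w. if v = w then (\<Sum>u\<in>UNIV - {v}. real (edge_mult G v u))
                          else - real (edge_mult G v w))"

definition charpoly :: "real ^ 'n ^ 'n \<Rightarrow> real poly" where
  "charpoly M = det (\<chi> i j. (if i = j then [:0, 1:] else 0) - [:M $ i $ j:])"

definition eigenvalues_list :: "real ^ 'n ^ 'n \<Rightarrow> real list" where
  "eigenvalues_list M = sorted_list_of_multiset (proots (charpoly M))"

text \<open>\<open>eigenvalues_list\<close> is in increasing order with multiplicities; list indices start at \<open>0\<close>.\<close>

definition algebraic_connectivity :: "('v::finite) multigraph \<Rightarrow> real" where
  "algebraic_connectivity G = eigenvalues_list (laplacian G) ! 1"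

text \<open>A single edge on two vertices (\<open>gon = 1\<close>, \<open>d = 1\<close>, \<open>\<lambda>\<^sub>2 = 2\<close>) violates the gonality bound
  \<open>|V| / (2 \<lambda>\<^sub>2) * (-(7 \<lambda>\<^sub>2 + 9 d) + 3 sqrt (9 \<lambda>\<^sub>2\<^sup>2 + 14 d \<lambda>\<^sub>2 + 9 d\<^sup>2))\<close>, whose value there is
  \<open>(3 sqrt 73 - 23) / 2 > 1\<close>. This is why that graph has to be excluded as a hypothesis.\<close>

abbreviation K2 :: "bool multigraph" where
  "K2 \<equiv> {#Upair False True#}"

lemma K2_mult: "edge_mult K2 v w = (if v = w then 0 else 1)"
  unfolding edge_mult_def by (cases v; cases w) auto

lemma K2_connected: "connected_multigraph K2"
  unfolding connected_multigraph_def
proof (intro allI)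
  fix v w show "(v, w) \<in> {(x, y). Upair x y \<in># K2}\<^sup>*"
    by (cases "v = w") (auto intro!: r_into_rtrancl)
qed

lemma K2_valence: "max_valence K2 = 1"
proof -
  have "UNIV - {v} = {\<not> v}" for v by auto
  then have "valence K2 = (\<lambda>_. 1)" by (auto simp: fun_eq_iff valence_def K2_mult)
  then show ?thesis by (simp add: max_valence_def)
qed

lemma K2_gonality: "gonality K2 = 1"
proof -
  have c: "UNIV - {v} = {\<not> v}" for v by auto
  have pr: "positive_rank K2 (\<lambda>v. if v then 1 else 0)"
    unfolding positive_rank_def
  proof
    fix v
    show "\<exists>E. effective E \<and> divisor_equiv K2 (\<lambda>w. (if w then 1 else 0) - (if w = v then 1 else 0)) E"
    proof (rule exI[of _ "\<lambda>_. 0"], rule conjI)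
      show "divisor_equiv K2 (\<lambda>w. (if w then 1 else 0) - (if w = v then 1 else 0)) (\<lambda>_. 0)"
        unfolding divisor_equiv_def
        by (rule exI[of _ "\<lambda>x. if x \<and> \<not> v then 1 else 0"]) 
           (cases v; auto simp: firing_move_def K2_mult UNIV_bool c)
    qed (simp add: effective_def)
  qed
  have deg: "divisor_degree (\<lambda>v::bool. if v then 1 else 0) = 1"
    by (simp add: divisor_degree_def UNIV_bool)
  have pos: "k \<ge> 1" if k: "\<exists>D. positive_rank K2 D \<and> divisor_degree D = k" for k
  proof -
    from k obtain D where D: "positive_rank K2 D" "divisor_degree D = k" by auto
    from D(1)[unfolded positive_rank_def, rule_format, of True] obtain E f where
      E: "effective E" "\<And>w. E w = D w - (if w = True then 1 else 0) + (\<Sum>v\<in>UNIV. f v * firing_move K2 v w)"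
      unfolding divisor_equiv_def by blast
    have "E True + E False = D True + D False - 1"
      using E(2)[of True] E(2)[of False] by (simp add: UNIV_bool firing_move_def K2_mult c)
    then show ?thesis using E(1) D(2) by (simp add: effective_def divisor_degree_def UNIV_bool)
       (smt (verit))
  qed
  show ?thesis unfolding gonality_def
    by (rule Least_equality) (use pr deg pos in auto)
qed

lemma det_bool:
  "det (A :: 'a::comm_ring_1 ^ bool ^ bool) =
     A $ False $ False * A $ True $ True - A $ False $ True * A $ True $ False"
proof -
  have f: "finite {True}" "False \<notin> {True}" "finite {}" by auto
  show ?thesis
    unfolding det_def UNIV_bool
    unfolding sum_over_permutations_insert[OF f(1,2)] permutes_sing
    by (simp add: sign_swap_id sign_id)
qed

lemma K2_lambda: "algebraic_connectivity K2 = 2"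
proof -
  have c: "UNIV - {v} = {\<not> v}" for v by auto
  have "charpoly (laplacian K2) = [:0, 1:] * [:-2, 1:]"
    by (simp add: charpoly_def laplacian_def det_bool K2_mult c)
  also have "proots \<dots> = {#0, 2#}"
    using proots_linear_factor[of "0::real"] proots_linear_factor[of "-2::real"]
    by (subst proots_mult) auto
  finally have "eigenvalues_list (laplacian K2) = [0, 2]"
    by (simp add: eigenvalues_list_def)
  then show ?thesis by (simp add: algebraic_connectivity_def)
qed

lemma K2_violates_bound:
  fixes n d l :: real
  defines "n \<equiv> real CARD(bool)" and "d \<equiv> real (max_valence K2)" and "l \<equiv> algebraic_connectivity K2"
  shows "real_of_int (gonality K2) <
    n / (2 * l) * (- (7 * l + 9 * d) + 3 * sqrt (9 * l\<^sup>2 + 14 * d * l + 9 * d\<^sup>2))"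
proof -
  have "sqrt 73 > 25 / 3" by (rule real_less_rsqrt) (simp add: power2_eq_square)
  then show ?thesis by (simp add: n_def d_def l_def K2_lambda K2_valence K2_gonality)
qed

end

theory Submission
  imports Defs
begin

text \<open>
  Let \<open>D\<close> have positive rank and degree \<open>g\<close>, and write \<open>n = |V(G)|\<close>, \<open>\<lambda> = \<lambda>\<^sub>2\<close>. The claimed
  lower bound is the positive root \<open>x\<close> of the quadratic equation
  \<open>9 n d x = \<lambda> (n - x) (8 n + x)\<close>, so it suffices to refute
  \<open>9 n d g < \<lambda> (n - g) (8 n + g)\<close> (\<open>positive_rank_degree_bound\<close>).

  The expression \<open>(n - g) (8 n + g) / (9 n)\<close> is the spectral cost of a separator. If removing a set
  \<open>S\<close> of \<open>g\<close> vertices leaves two parts \<open>A\<close>, \<open>B\<close> without edges between them, the test function that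
  is \<open>1\<close> on \<open>A\<close>, \<open>-1\<close> on \<open>B\<close> and \<open>0\<close> on \<open>S\<close> has Dirichlet energy at most \<open>d g\<close>. If both parts
  contain at least a third of the remaining \<open>n - g\<close> vertices, its variance is at least
  \<open>(n - g) - (n - g)\<^sup>2 / (9 n)\<close>. The variational characterisation of \<open>\<lambda>\<close> then gives
  \<open>9 n d g \<ge> \<lambda> (n - g) (8 n + g)\<close>, the opposite of the assumed inequality. Hence no set of \<open>g\<close>
  vertices has such a balanced separation, and this means that every set of at most \<open>g\<close> vertices
  misses some connected set with more than \<open>2 (n - g) / 3\<close> vertices (\<open>balanced_split\<close>). Call these
  connected sets eggs.

  In particular the support of each effective divisor equivalent to \<open>D\<close> misses an egg. By the
  theory of scrambles (\<open>scramble_cut\<close>), moving from one effective divisor to another by firing level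
  sets then must at some moment fire a set \<open>U\<close> that contains one egg and avoids another one, and
  such a firing needs at least as many chips as there are edges leaving \<open>U\<close>. So \<open>U\<close> has at most \<open>g\<close>
  boundary edges although both \<open>U\<close> and its complement are large. If \<open>g \<le> n / 4\<close>, two eggs always
  meet, which is absurd. Otherwise, the indicator function of \<open>U\<close> as a test function contradicts the
  assumed inequality when \<open>d \<ge> 3\<close>. For \<open>d = 2\<close> it does so when \<open>g = 1\<close>; and when \<open>g \<ge> 2\<close> a
  direct upper bound for \<open>\<lambda>\<close> (\<open>algebraic_connectivity_le_if_max_valence_2\<close>) does. Only the single
  edge, which is excluded, has \<open>d \<le> 1\<close>.
\<close>

no_notation fps_nth (infixl "$" 75)

section \<open>Variational characterisation of the algebraic connectivity\<close>

lemma edge_mult_commute: "edge_mult G v w = edge_mult G w v"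
  unfolding edge_mult_def by (rule arg_cong[of _ _ "count G"]) auto

lemma laplacian_mult_nth:
  "(laplacian G *v f) $ v = (\<Sum>w\<in>UNIV. real (edge_mult G v w) * (f $ v - f $ w))"
proof -
  have "(laplacian G *v f) $ v = (\<Sum>w\<in>UNIV. laplacian G $ v $ w * f $ w)"
    by (simp add: matrix_vector_mult_def)
  also have "\<dots> = laplacian G $ v $ v * f $ v + (\<Sum>w\<in>UNIV-{v}. laplacian G $ v $ w * f $ w)"
    by (simp add: sum.remove)
  also have "(\<Sum>w\<in>UNIV-{v}. laplacian G $ v $ w * f $ w) = (\<Sum>w\<in>UNIV-{v}. - real (edge_mult G v w) * f $ w)"
    by (rule sum.cong) (auto simp: laplacian_def)
  also have "laplacian G $ v $ v * f $ v = (\<Sum>w\<in>UNIV-{v}. real (edge_mult G v w) * f $ v)"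
    by (simp add: laplacian_def sum_distrib_right)
  also have "(\<Sum>w\<in>UNIV-{v}. real (edge_mult G v w) * f $ v) + (\<Sum>w\<in>UNIV-{v}. - real (edge_mult G v w) * f $ w)
      = (\<Sum>w\<in>UNIV-{v}. real (edge_mult G v w) * (f $ v - f $ w))"
    by (simp add: sum.distrib[symmetric] algebra_simps)
  also have "\<dots> = (\<Sum>w\<in>UNIV. real (edge_mult G v w) * (f $ v - f $ w))"
    by (simp add: sum.remove[of UNIV v])
  finally show ?thesis .
qed

text \<open>Summation by parts. The right-hand side is symmetric in \<open>h\<close> and \<open>f\<close> and vanishes for constant
  \<open>h\<close>; for \<open>h = f\<close> it is the Dirichlet energy, in which every edge is counted once because of the
  factor \<open>1/2\<close>.\<close>

lemma inner_laplacian: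
  "h \<bullet> (laplacian G *v f) =
     (\<Sum>v\<in>UNIV. \<Sum>w\<in>UNIV. real (edge_mult G v w) * ((h $ v - h $ w) * (f $ v - f $ w))) / 2"
proof -
  let ?T = "\<lambda>v w. real (edge_mult G v w) * (h $ v * (f $ v - f $ w))"
  have "h \<bullet> (laplacian G *v f) = (\<Sum>v\<in>UNIV. \<Sum>w\<in>UNIV. ?T v w)"
    by (simp add: inner_vec_def laplacian_mult_nth sum_distrib_left algebra_simps)
  moreover have "(\<Sum>v\<in>UNIV. \<Sum>w\<in>UNIV. ?T v w) = (\<Sum>v\<in>UNIV. \<Sum>w\<in>UNIV. ?T w v)"
    by (rule sum.swap)
  moreover have "(\<Sum>v\<in>UNIV. \<Sum>w\<in>UNIV. ?T v w) + (\<Sum>v\<in>UNIV. \<Sum>w\<in>UNIV. ?T w v) =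
     (\<Sum>v\<in>UNIV. \<Sum>w\<in>UNIV. real (edge_mult G v w) * ((h $ v - h $ w) * (f $ v - f $ w)))"
    unfolding sum.distrib[symmetric]
    by (intro sum.cong refl) (subst edge_mult_commute, simp add: algebra_simps)
  ultimately show ?thesis by simp
qed

lemma poly_charpoly: "poly (charpoly M) x = det (mat x - M)"
  by (simp add: charpoly_def det_def poly_sum poly_prod mat_def if_distrib[of "\<lambda>p. poly p x"] cong: if_cong)

lemma mat_diff_mult: "(mat x - M) *v f = x *\<^sub>R f - (M :: real^'n^'n) *v f"
proof -
  have "mat x *v f = x *\<^sub>R f" 
    by (simp add: vec_eq_iff matrix_vector_mult_def mat_def if_distrib[of "\<lambda>c. c * _"] sum.delta cong: if_cong)
  then show ?thesis by (simp add: matrix_vector_mult_diff_rdistrib)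
qed

lemma root_charpoly_iff:
  "poly (charpoly (M :: real^'n^'n)) x = 0 \<longleftrightarrow> (\<exists>f. f \<noteq> 0 \<and> M *v f = x *\<^sub>R f)"
proof -
  have "poly (charpoly M) x \<noteq> 0 \<longleftrightarrow> (\<forall>f. (mat x - M) *v f = 0 \<longrightarrow> f = 0)"
    unfolding poly_charpoly using invertible_det_nz[of "mat x - M"] 
      matrix_left_invertible_ker[of "mat x - M"] invertible_left_inverse[of "mat x - M"] by metis
  then show ?thesis by (auto simp: mat_diff_mult)
qed

text \<open>A function of zero energy is constant along every edge.\<close>

lemma laplacian_kernel:
  fixes G :: "('v::finite) multigraph"
  assumes "connected_multigraph G" and "f \<bullet> (laplacian G *v f) = 0"
  shows "f $ v = f $ w"
proof -
  have nonneg: "0 \<le> real (edge_mult G v w) * ((f $ v - f $ w) * (f $ v - f $ w))" for v w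
    by simp
  have "(\<Sum>v\<in>UNIV. \<Sum>w\<in>UNIV. real (edge_mult G v w) * ((f $ v - f $ w) * (f $ v - f $ w))) = 0"
    using assms(2) by (simp add: inner_laplacian)
  then have "real (edge_mult G x y) * ((f $ x - f $ y) * (f $ x - f $ y)) = 0" for x y
    using nonneg by (simp add: sum_nonneg_eq_0_iff sum_nonneg)
  then have edge: "f $ x = f $ y" if "Upair x y \<in># G" for x y
    using that by (metis count_eq_zero_iff edge_mult_def eq_iff_diff_eq_0 mult_eq_0_iff of_nat_eq_0_iff)
  have "(v, w) \<in> {(x, y). Upair x y \<in># G}\<^sup>*"
    using assms(1) by (simp add: connected_multigraph_def)
  then show ?thesis by (induction rule: rtrancl_induct) (auto dest: edge)
qed

text \<open>Summation by parts. The right-hand side is symmetric in \<open>h\<close> and \<open>f\<close> and vanishes for constant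
  \<open>h\<close>; for \<open>h = f\<close> it is the Dirichlet energy, in which every edge is counted once because of the
  factor \<open>1/2\<close>.\<close>

lemma inner_laplacian_nonneg: "0 \<le> f \<bullet> (laplacian G *v f)"
  unfolding inner_laplacian by (intro divide_nonneg_pos sum_nonneg) auto

text \<open>Needed because the zero polynomial has no roots in the sense of \<^const>\<open>proots\<close>. Since the
  Laplacian is positive semidefinite, \<open>-1\<close> is not an eigenvalue.\<close>

lemma charpoly_laplacian_nonzero: "charpoly (laplacian G) \<noteq> 0"
proof
  assume "charpoly (laplacian G) = 0"
  then have "poly (charpoly (laplacian G)) (-1) = 0" by simp
  then obtain f where f: "f \<noteq> 0" "laplacian G *v f = (-1) *\<^sub>R f" by (auto simp: root_charpoly_iff)
  then have "f \<bullet> (laplacian G *v f) = - (f \<bullet> f)" by simp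
  moreover have "f \<bullet> f > 0" using f(1) by simp
  ultimately show False using inner_laplacian_nonneg[of f G] by linarith
qed

text \<open>This reads off a bound for \<open>\<lambda>\<^sub>2\<close> from any two distinct eigenvalues, whatever the rest of the
  spectrum and the multiplicities are.\<close>

lemma second_of_sorted_le:
  fixes xs :: "real list"
  assumes "sorted xs" "a \<in> set xs" "b \<in> set xs" "a < b"
  shows "xs ! 1 \<le> b"
proof -
  obtain i j where ij: "i < length xs" "xs ! i = a" "j < length xs" "xs ! j = b"
    using assms(2,3) by (auto simp: in_set_conv_nth)
  have "xs ! 0 \<le> a" using ij assms(1) sorted_nth_mono[of xs 0 i] by simp
  then have "j \<noteq> 0" using ij(4) assms(4) by (intro notI) simp
  then show ?thesis using ij assms(1) sorted_nth_mono[of xs 1 j] by simp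
qed

text \<open>The Rayleigh quotient attains its minimum \<open>\<mu>\<close> on the compact unit sphere of the hyperplane
  orthogonal to the constants, and the first variation shows that a minimiser is an eigenvector.\<close>

lemma exists_laplacian_eigenvector_minimising:
  fixes G :: "('v::finite) multigraph"
  assumes "CARD('v) \<ge> 2"
  obtains w \<mu> where "w \<noteq> 0" "w \<bullet> 1 = 0" "laplacian G *v w = \<mu> *\<^sub>R w"
    and "\<And>f. f \<bullet> 1 = 0 \<Longrightarrow> \<mu> * (f \<bullet> f) \<le> f \<bullet> (laplacian G *v f)"
proof -
  define L where "L = (*v) (laplacian G)"
  define S where "S = sphere 0 1 \<inter> {f :: real^'v. f \<bullet> 1 = 0}"
  interpret L: linear L unfolding L_def by (rule matrix_vector_mul_linear)
  obtain a b :: 'v where ab: "a \<noteq> b"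
  proof -
    obtain T :: "'v set" where "card T = 2" using assms by (rule obtain_subset_with_card_n)
    then show ?thesis using that by (auto simp: card_2_iff)
  qed
  define h :: "real^'v" where "h = axis a 1 - axis b 1"
  have h1: "h \<bullet> 1 = 0" by (simp add: h_def inner_diff_left inner_axis')
  have h0: "h \<noteq> 0" using ab by (metis axis_eq_axis eq_iff_diff_eq_0 h_def one_neq_zero)
  have "h /\<^sub>R norm h \<in> S" using h0 h1 by (simp add: S_def)
  moreover have "compact S" unfolding S_def
    by (intro compact_Int_closed compact_sphere closed_Collect_eq continuous_intros)
  moreover have "continuous_on S (\<lambda>f. f \<bullet> L f)" unfolding L_def
    by (intro continuous_intros)
  ultimately obtain w where w: "w \<in> S" "\<And>f. f \<in> S \<Longrightarrow> w \<bullet> L w \<le> f \<bullet> L f"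
    using continuous_attains_inf[of S "\<lambda>f. f \<bullet> L f"] by blast
  define \<mu> where "\<mu> = w \<bullet> L w"
  have w1: "w \<bullet> 1 = 0" and ww: "w \<bullet> w = 1" using w(1) by (auto simp: S_def norm_eq_1)
  have sym: "f \<bullet> L g = g \<bullet> L f" for f g
    unfolding L_def inner_laplacian by (simp add: mult.commute)
  have min: "\<mu> * (f \<bullet> f) \<le> f \<bullet> L f" if f: "f \<bullet> 1 = 0" for f
  proof (cases "f = 0")
    case False
    have "f /\<^sub>R norm f \<in> S" using f False by (simp add: S_def)
    then have "\<mu> \<le> (f /\<^sub>R norm f) \<bullet> L (f /\<^sub>R norm f)" unfolding \<mu>_def by (rule w(2))
    also have "\<dots> = (f \<bullet> L f) / (f \<bullet> f)"
      by (simp add: L.scaleR dot_square_norm power2_eq_square divide_inverse)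
    finally show ?thesis using False by (simp add: field_simps)
  qed (simp add: L.zero)
  define r where "r = L w - \<mu> *\<^sub>R w"
  have "L w \<bullet> 1 = 0"
    unfolding inner_commute[of "L w"] by (simp add: L_def inner_laplacian)
  then have r1: "r \<bullet> 1 = 0" using w1 by (simp add: r_def inner_diff_left)
  \<comment> \<open>First variation: the minimum at \<open>w\<close> gives a quadratic in \<open>t\<close> without constant term that is
    nonnegative for all \<open>t\<close>, so that its linear coefficient, which is \<open>2 * (r \<bullet> r)\<close>, vanishes.\<close>
  have var: "0 \<le> 2 * t * (r \<bullet> r) + t\<^sup>2 * (r \<bullet> L r - \<mu> * (r \<bullet> r))" for t
  proof -
    have "\<mu> * ((w + t *\<^sub>R r) \<bullet> (w + t *\<^sub>R r)) \<le> (w + t *\<^sub>R r) \<bullet> L (w + t *\<^sub>R r)"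
      using w1 r1 by (intro min) (simp add: inner_add_left)
    then have "0 \<le> 2 * t * (r \<bullet> L w - \<mu> * (r \<bullet> w)) + t\<^sup>2 * (r \<bullet> L r - \<mu> * (r \<bullet> r))"
      using ww sym[of w r] inner_commute[of w r] \<mu>_def
      by (simp add: L.add L.scaleR inner_add_left inner_add_right algebra_simps power2_eq_square)
    moreover have "r \<bullet> L w - \<mu> * (r \<bullet> w) = r \<bullet> r"
      by (simp add: r_def inner_diff_right)
    ultimately show ?thesis by simp
  qed
  have "r \<bullet> r = 0"
  proof (rule ccontr)
    assume "r \<bullet> r \<noteq> 0"
    then have pos: "r \<bullet> r > 0" by simp
    define c where "c = \<bar>r \<bullet> L r - \<mu> * (r \<bullet> r)\<bar> + 1"
    define t where "t = (r \<bullet> r) / c"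
    have c: "c > 0" by (simp add: c_def)
    have t: "t > 0" using pos c by (simp add: t_def)
    have "0 \<le> 2 * (-t) * (r \<bullet> r) + (-t)\<^sup>2 * (r \<bullet> L r - \<mu> * (r \<bullet> r))" by (rule var)
    also have "\<dots> \<le> 2 * (-t) * (r \<bullet> r) + (-t)\<^sup>2 * c"
      by (intro add_left_mono mult_left_mono) (auto simp: c_def)
    also have "\<dots> = - t * (r \<bullet> r)" using c by (simp add: t_def power2_eq_square)
    finally show False using mult_pos_pos[OF t pos] by linarith
  qed
  then have "L w = \<mu> *\<^sub>R w" by (simp add: r_def)
  moreover have "w \<noteq> 0" using ww by auto
  ultimately show ?thesis using that w1 min unfolding L_def by blast
qed

text \<open>Connectedness makes the minimal Rayleigh quotient \<open>\<mu>\<close> positive, so that \<open>0\<close> and \<open>\<mu>\<close> are two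
  different roots of the characteristic polynomial and the second entry of the sorted list of
  eigenvalues is at most \<open>\<mu>\<close>.\<close>

lemma algebraic_connectivity_le_rayleigh:
  fixes G :: "('v::finite) multigraph"
  assumes "connected_multigraph G" and "CARD('v) \<ge> 2" and "f \<bullet> 1 = 0"
  shows "algebraic_connectivity G * (f \<bullet> f) \<le> f \<bullet> (laplacian G *v f)"
proof -
  obtain w \<mu> where w: "w \<noteq> 0" "w \<bullet> 1 = 0" "laplacian G *v w = \<mu> *\<^sub>R w"
    and min: "\<And>f. f \<bullet> 1 = 0 \<Longrightarrow> \<mu> * (f \<bullet> f) \<le> f \<bullet> (laplacian G *v f)"
    using exists_laplacian_eigenvector_minimising[OF assms(2), of G] by blast
  have "w \<bullet> (laplacian G *v w) \<noteq> 0"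
  proof
    assume "w \<bullet> (laplacian G *v w) = 0"
    then have const: "w $ x = w $ y" for x y by (rule laplacian_kernel[OF assms(1)])
    have "w $ x = 0" for x
    proof -
      have "w \<bullet> 1 = (\<Sum>v\<in>(UNIV :: 'v set). w $ x)"
        unfolding inner_vec_def by (intro sum.cong refl) (simp, rule const)
      then show ?thesis using w(2) by simp
    qed
    then show False using w(1) by (simp add: vec_eq_iff)
  qed
  moreover have "w \<bullet> (laplacian G *v w) = \<mu> * (w \<bullet> w)" by (simp add: w(3))
  ultimately have "0 < \<mu> * (w \<bullet> w)" using inner_laplacian_nonneg[of w G] by linarith
  then have \<mu>: "\<mu> > 0" by (rule zero_less_mult_pos2) (simp add: w(1))
  have "laplacian G *v 1 = 0 *\<^sub>R 1" by (simp add: vec_eq_iff laplacian_mult_nth)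
  then have "poly (charpoly (laplacian G)) 0 = 0" unfolding root_charpoly_iff
    by (intro exI[of _ 1]) (simp add: vec_eq_iff)
  moreover have "poly (charpoly (laplacian G)) \<mu> = 0"
    unfolding root_charpoly_iff using w by blast
  ultimately have "0 \<in> set (eigenvalues_list (laplacian G))" "\<mu> \<in> set (eigenvalues_list (laplacian G))"
    by (simp_all add: eigenvalues_list_def charpoly_laplacian_nonzero)
  moreover have "sorted (eigenvalues_list (laplacian G))" 
    by (simp add: eigenvalues_list_def)
  ultimately have "algebraic_connectivity G \<le> \<mu>"
    unfolding algebraic_connectivity_def using \<mu> by (intro second_of_sorted_le[of _ 0])
  then have "algebraic_connectivity G * (f \<bullet> f) \<le> \<mu> * (f \<bullet> f)"
    by (simp add: mult_right_mono)
  then show ?thesis using min[OF assms(3)] by simp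
qed

text \<open>The same inequality for functions that need not be orthogonal to the constants: subtracting the
  mean does not change the energy, and turns the squared norm into \<open>n\<close> times the variance.\<close>

lemma algebraic_connectivity_poincare:
  fixes G :: "('v::finite) multigraph" and f :: "'v \<Rightarrow> real"
  assumes "connected_multigraph G" and "CARD('v) \<ge> 2"
  shows "algebraic_connectivity G * ((\<Sum>v\<in>UNIV. (f v)\<^sup>2) - (\<Sum>v\<in>UNIV. f v)\<^sup>2 / real CARD('v))
    \<le> (\<Sum>v\<in>UNIV. \<Sum>w\<in>UNIV. real (edge_mult G v w) * (f v - f w)\<^sup>2) / 2"
proof -
  define n where "n = real CARD('v)"
  define m where "m = (\<Sum>v\<in>UNIV. f v) / n"
  define h :: "real^'v" where "h = (\<chi> v. f v - m)"
  have n: "n > 0" by (simp add: n_def)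
  have "h \<bullet> 1 = (\<Sum>v\<in>UNIV. f v) - n * m"
    by (simp add: h_def inner_vec_def sum_subtractf n_def)
  then have h1: "h \<bullet> 1 = 0" using n by (simp add: m_def)
  have "h \<bullet> h = (\<Sum>v\<in>UNIV. (f v)\<^sup>2 - 2 * m * f v + m\<^sup>2)"
    by (simp add: h_def inner_vec_def power2_eq_square algebra_simps)
  also have "\<dots> = (\<Sum>v\<in>UNIV. (f v)\<^sup>2) - 2 * m * (\<Sum>v\<in>UNIV. f v) + n * m\<^sup>2"
    by (simp add: sum.distrib sum_subtractf sum_distrib_left n_def)
  also have "\<dots> = (\<Sum>v\<in>UNIV. (f v)\<^sup>2) - (\<Sum>v\<in>UNIV. f v)\<^sup>2 / n"
    using n by (simp add: m_def power2_eq_square field_simps)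
  finally have hh: "h \<bullet> h = (\<Sum>v\<in>UNIV. (f v)\<^sup>2) - (\<Sum>v\<in>UNIV. f v)\<^sup>2 / n" .
  have "h \<bullet> (laplacian G *v h) = (\<Sum>v\<in>UNIV. \<Sum>w\<in>UNIV. real (edge_mult G v w) * (f v - f w)\<^sup>2) / 2"
    by (simp add: inner_laplacian h_def power2_eq_square)
  then show ?thesis
    using algebraic_connectivity_le_rayleigh[OF assms h1] unfolding hh n_def by (rule subst)
qed

section \<open>Spectral bounds for cuts and separators\<close>

definition cut_size :: "('v::finite) multigraph \<Rightarrow> 'v set \<Rightarrow> nat" where
  "cut_size G U = (\<Sum>v\<in>U. \<Sum>w\<in>-U. edge_mult G v w)"

lemma sum_edge_mult_le_max_valence:
  fixes G :: "('v::finite) multigraph"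
  assumes "v \<notin> W"
  shows "(\<Sum>w\<in>W. edge_mult G v w) \<le> max_valence G"
proof -
  have "(\<Sum>w\<in>W. edge_mult G v w) \<le> (\<Sum>w\<in>UNIV - {v}. edge_mult G v w)"
    using assms by (intro sum_mono2) auto
  also have "\<dots> \<le> valence G v" by (simp add: valence_def)
  also have "\<dots> \<le> max_valence G" by (simp add: max_valence_def)
  finally show ?thesis .
qed

lemma cut_size_compl: "cut_size G (- U) = cut_size G U"
  unfolding cut_size_def
  by (simp add: sum.swap[of _ "-U" U]) (intro sum.cong refl edge_mult_commute)

text \<open>The Poincare inequality for the indicator function of \<open>U\<close>.\<close>

lemma algebraic_connectivity_le_cut:
  fixes G :: "('v::finite) multigraph"
  assumes "connected_multigraph G" and "CARD('v) \<ge> 2"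
  shows "algebraic_connectivity G * real (card U) * real (card (- U)) \<le> real CARD('v) * real (cut_size G U)"
proof -
  define f :: "'v \<Rightarrow> real" where "f v = (if v \<in> U then 1 else 0)" for v
  define n where "n = real CARD('v)"
  have n: "n > 0" by (simp add: n_def)
  have card: "n = real (card U) + real (card (- U))"
    using card_Un_disjoint[of U "- U"] by (simp add: n_def Compl_partition flip: of_nat_add)
  have f2: "(\<Sum>v\<in>UNIV. (f v)\<^sup>2) = real (card U)" and f1: "(\<Sum>v\<in>UNIV. f v) = real (card U)"
    by (simp_all add: f_def if_distrib[of "\<lambda>c. c\<^sup>2"] sum.If_cases cong: if_cong)
  have "(\<Sum>v\<in>UNIV. \<Sum>w\<in>UNIV. real (edge_mult G v w) * (f v - f w)\<^sup>2)
      = (\<Sum>v\<in>UNIV. if v \<in> U then \<Sum>w\<in>-U. real (edge_mult G v w) else \<Sum>w\<in>U. real (edge_mult G v w))"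
    by (intro sum.cong refl) (simp add: f_def if_distrib[of "\<lambda>c. c\<^sup>2"] if_distrib[of "\<lambda>c. _ * c"]
        if_distrib[of "\<lambda>c. _ - c"] sum.If_cases cong: if_cong)
  also have "\<dots> = real (cut_size G U) + real (cut_size G (- U))"
    by (simp add: sum.If_cases cut_size_def)
  finally have "algebraic_connectivity G * (real (card U) - (real (card U))\<^sup>2 / n) \<le> real (cut_size G U)"
    using algebraic_connectivity_poincare[OF assms, of f] by (simp add: cut_size_compl f1 f2 n_def)
  then have "n * (algebraic_connectivity G * (real (card U) - (real (card U))\<^sup>2 / n)) \<le> n * real (cut_size G U)"
    using n by (intro mult_left_mono) auto
  moreover have "n * (algebraic_connectivity G * (real (card U) - (real (card U))\<^sup>2 / n)) =
      algebraic_connectivity G * real (card U) * real (card (- U))"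
    using n card by (simp add: field_simps power2_eq_square)
  ultimately show ?thesis unfolding n_def by metis
qed

text \<open>The Poincare inequality for the function that is \<open>1\<close> on \<open>A\<close>, \<open>-1\<close> on \<open>B\<close> and \<open>0\<close> on \<open>S\<close>: only
  the edges that leave \<open>S\<close> contribute to its energy, one unit each.\<close>

lemma algebraic_connectivity_le_separator:
  fixes G :: "('v::finite) multigraph"
  assumes "connected_multigraph G" and "CARD('v) \<ge> 2"
    and part: "A \<inter> B = {}" "A \<inter> S = {}" "B \<inter> S = {}" "A \<union> B \<union> S = UNIV"
    and sep: "\<And>a b. a \<in> A \<Longrightarrow> b \<in> B \<Longrightarrow> edge_mult G a b = 0"
  shows "algebraic_connectivity G * (real (card A) + real (card B)
      - (real (card A) - real (card B))\<^sup>2 / real CARD('v)) \<le> real (max_valence G) * real (card S)"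
proof -
  define f :: "'v \<Rightarrow> real" where "f v = (if v \<in> A then 1 else if v \<in> B then -1 else 0)" for v
  have UN: "(\<Sum>v\<in>UNIV. g v) = (\<Sum>v\<in>A. g v) + (\<Sum>v\<in>B. g v) + (\<Sum>v\<in>S. g v)" for g :: "'v \<Rightarrow> real"
    unfolding part(4)[symmetric] using part by (subst sum.union_disjoint; auto simp: sum.union_disjoint)
  have fA: "f v = 1" if "v \<in> A" for v using that by (simp add: f_def)
  have fB: "f v = -1" if "v \<in> B" for v using that part by (auto simp: f_def)
  have fS: "f v = 0" if "v \<in> S" for v using that part by (auto simp: f_def)
  have f1: "(\<Sum>v\<in>UNIV. f v) = real (card A) - real (card B)"
    by (simp add: UN fA fB fS)
  have f2: "(\<Sum>v\<in>UNIV. (f v)\<^sup>2) = real (card A) + real (card B)"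
    by (simp add: UN fA fB fS)
  have sep': "edge_mult G b a = 0" if "a \<in> A" "b \<in> B" for a b
    using sep[OF that] by (simp add: edge_mult_commute)
  define e where "e X Y = (\<Sum>v\<in>X. \<Sum>w\<in>Y. real (edge_mult G v w))" for X Y
  have e_swap: "e X Y = e Y X" for X Y
    unfolding e_def by (subst sum.swap) (intro sum.cong refl arg_cong[of _ _ real] edge_mult_commute)
  have "(\<Sum>v\<in>UNIV. \<Sum>w\<in>UNIV. real (edge_mult G v w) * (f v - f w)\<^sup>2)
      = e A S + e B S + (e S A + e S B)"
    unfolding UN sum.distrib e_def using sep sep' by (simp add: fA fB fS)
  also have "\<dots> = 2 * e S (A \<union> B)"
    unfolding e_swap[of A] e_swap[of B] using part by (simp add: e_def sum.union_disjoint sum.distrib)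
  also have "e S (A \<union> B) \<le> (\<Sum>v\<in>S. real (max_valence G))"
    unfolding e_def of_nat_sum[symmetric] of_nat_le_iff using part
    by (intro sum_mono of_nat_mono sum_edge_mult_le_max_valence) auto
  finally show ?thesis
    using algebraic_connectivity_poincare[OF assms(1,2), of f] unfolding f1 f2
    by (simp add: mult.commute)
qed

section \<open>Sets with few boundary edges\<close>

lemma ex_boundary_edge:
  fixes G :: "('v::finite) multigraph"
  assumes "connected_multigraph G" and "v \<in> U" and "w \<notin> U"
  shows "\<exists>x\<in>U. \<exists>y\<in>-U. edge_mult G x y > 0"
proof (rule ccontr)
  assume none: "\<not> ?thesis"
  have "(v, w) \<in> {(x, y). Upair x y \<in># G}\<^sup>*"
    using assms(1) by (simp add: connected_multigraph_def)
  then have "w \<in> U"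
  proof (induction rule: rtrancl_induct)
    case (step y z)
    then show ?case using none by (auto simp: edge_mult_def)
  qed (use assms in simp)
  then show False using assms by simp
qed

text \<open>Grow the set vertex by vertex, always adding an outside neighbour. A new vertex brings at most
  \<open>d\<close> edges, and at least one of them joins it to the old set: this edge leaves the boundary and
  does not enter it again, so that the boundary grows by at most \<open>d - 2\<close>.\<close>

lemma exists_set_with_small_cut:
  fixes G :: "('v::finite) multigraph"
  assumes conn: "connected_multigraph G" and "1 \<le> k" "k \<le> CARD('v)"
  shows "\<exists>A. card A = k \<and> int (cut_size G A) \<le> (int (max_valence G) - 2) * int k + 2"
  using assms(2,3)
proof (induction k rule: dec_induct)
  case base
  fix v :: 'v
  have "cut_size G {v} \<le> max_valence G"
    using sum_edge_mult_le_max_valence[of v "- {v}" G] by (simp add: cut_size_def)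
  then show ?case by (intro exI[of _ "{v}"]) simp
next
  case (step k)
  then obtain A where A: "card A = k" "int (cut_size G A) \<le> (int (max_valence G) - 2) * int k + 2"
    by auto
  have "A \<noteq> {}" "A \<noteq> UNIV" using A(1) step by auto
  then obtain x y where xy: "x \<in> A" "y \<notin> A" "edge_mult G x y > 0"
    using ex_boundary_edge[OF conn] by (metis ComplD UNIV_eq_I all_not_in_conv)
  define B where "B = insert y A"
  have comp: "- A = insert y (- B)" using xy by (auto simp: B_def)
  have "cut_size G A = (\<Sum>v\<in>A. edge_mult G v y) + (\<Sum>v\<in>A. \<Sum>w\<in>- B. edge_mult G v w)"
    unfolding cut_size_def comp by (simp add: B_def sum.distrib)
  moreover have "(\<Sum>v\<in>A. edge_mult G v y) \<ge> 1"
    using member_le_sum[of x A "\<lambda>v. edge_mult G v y"] xy by simp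
  moreover have "cut_size G B = (\<Sum>w\<in>- B. edge_mult G y w) + (\<Sum>v\<in>A. \<Sum>w\<in>- B. edge_mult G v w)"
    unfolding cut_size_def using xy(2) by (simp add: B_def)
  moreover have "(\<Sum>w\<in>- B. edge_mult G y w) + (\<Sum>v\<in>A. edge_mult G v y) \<le> max_valence G"
  proof -
    have "(\<Sum>v\<in>A. edge_mult G v y) = (\<Sum>v\<in>A. edge_mult G y v)"
      by (intro sum.cong refl edge_mult_commute)
    moreover have "(\<Sum>w\<in>- B \<union> A. edge_mult G y w) = (\<Sum>w\<in>- B. edge_mult G y w) + (\<Sum>v\<in>A. edge_mult G y v)"
      by (intro sum.union_disjoint) (auto simp: B_def)
    moreover have "(\<Sum>w\<in>- B \<union> A. edge_mult G y w) \<le> max_valence G"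
      using xy by (intro sum_edge_mult_le_max_valence) (auto simp: B_def)
    ultimately show ?thesis by simp
  qed
  ultimately have "int (cut_size G B) \<le> int (cut_size G A) + int (max_valence G) - 2"
    by linarith
  also have "\<dots> \<le> (int (max_valence G) - 2) * int (Suc k) + 2"
    using A(2) by (simp add: algebra_simps)
  finally show ?case using A(1) xy(2) by (intro exI[of _ B]) (simp add: B_def)
qed

text \<open>If \<open>d \<le> 1\<close>, the growth estimate yields a pair of vertices without boundary edges, so that these
  two are all the vertices and a single edge joins them.\<close>

lemma max_valence_ge_2:
  fixes G :: "('v::finite) multigraph"
  assumes conn: "connected_multigraph G" and n: "CARD('v) \<ge> 2"
    and not_K2: "\<not> (CARD('v) = 2 \<and> size G = 1)"
  shows "max_valence G \<ge> 2"
proof (rule ccontr)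
  assume "\<not> ?thesis"
  then have d: "max_valence G \<le> 1" by simp
  have val: "valence G v \<le> 1" for v
    using d Max_ge[of "range (valence G)" "valence G v"] by (simp add: max_valence_def)
  obtain A :: "'v set" where A: "card A = 2" "int (cut_size G A) \<le> (int (max_valence G) - 2) * 2 + 2"
    using exists_set_with_small_cut[OF conn _ n] by auto
  have "int (cut_size G A) \<le> 2 * int (max_valence G) - 2" using A(2) by simp
  then have "cut_size G A = 0" using d by linarith
  then have "A = UNIV"
  proof -
    have "edge_mult G x y = 0" if "x \<in> A" "y \<in> - A" for x y
      using \<open>cut_size G A = 0\<close> that by (auto simp: cut_size_def)
    then show ?thesis
      using ex_boundary_edge[OF conn, of _ A] A(1) by (metis UNIV_eq_I all_not_in_conv card.empty less_irrefl zero_neq_numeral)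
  qed
  then obtain v w :: 'v where vw: "UNIV = {v, w}" "v \<noteq> w" using A(1) card_2_iff[of A] by metis
  have all: "x = v \<or> x = w" for x using vw(1) by auto
  have diff: "UNIV - {v} = {w}" "UNIV - {w} = {v}" using vw by auto
  have mult: "edge_mult G v w \<le> 1" "edge_mult G v v = 0" "edge_mult G w w = 0"
    using val[of v] val[of w] by (simp_all add: valence_def diff)
  have "edge_mult G v w > 0"
    using ex_boundary_edge[OF conn, of v "{v}" w] vw(2) all by (metis ComplD singletonD singletonI)
  then have one: "edge_mult G v w = 1" using mult(1) by simp
  have "G = {#Upair v w#}"
  proof (rule multiset_eqI)
    fix p
    show "count G p = count {#Upair v w#} p"
    proof (cases p)
      case (Upair x y)
      then show ?thesis using all[of x] all[of y] one mult vw(2)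
        edge_mult_commute[of G v w] by (auto simp: edge_mult_def)
    qed
  qed
  moreover have "CARD('v) = 2" using A(1) \<open>A = UNIV\<close> by simp
  ultimately show False using not_K2 by simp
qed

lemma card_add_card_Compl:
  fixes A :: "('v::finite) set"
  shows "card A + card (- A) = CARD('v)"
  using card_Un_disjoint[of A "- A"] by (simp add: Compl_partition)

text \<open>For \<open>d = 2\<close> the growth estimate gives sets \<open>A\<close> of every size with at most two boundary edges, hence with a
  two-element separator \<open>S\<close> between \<open>A\<close> and the rest \<open>B\<close>. Taking for \<open>A\<close> half of the \<open>n - 2\<close>
  vertices, rounded down, makes the separation as balanced as possible. For \<open>n = 3\<close> rounding would
  leave \<open>A\<close> empty, and the cut around a single vertex is used instead.\<close>

lemma algebraic_connectivity_le_if_max_valence_2: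
  fixes G :: "('v::finite) multigraph"
  assumes conn: "connected_multigraph G" and n: "CARD('v) \<ge> 3" and d: "max_valence G = 2"
    and pos: "algebraic_connectivity G > 0"
  shows "algebraic_connectivity G * (real CARD('v) - 2) * (8 * real CARD('v) + 2) \<le> 36 * real CARD('v)"
proof -
  define l where "l = algebraic_connectivity G"
  define n where "n = real CARD('v)"
  have l: "l > 0" using pos by (simp add: l_def)
  have small_cut: "\<exists>A. card A = k \<and> cut_size G A \<le> 2" if "1 \<le> k" "k \<le> CARD('v)" for k
    using exists_set_with_small_cut[OF conn that] d by force
  consider "CARD('v) = 3" | "CARD('v) \<ge> 4" using n by linarith
  then show ?thesis
  proof cases
    case 1
    obtain A :: "'v set" where A: "card A = 1" "cut_size G A \<le> 2" using small_cut[of 1] 1 by auto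
    have "card (- A) = 2" using card_add_card_Compl[of A] A(1) 1 by linarith
    then have "l * 1 * 2 \<le> 3 * real (cut_size G A)"
      using algebraic_connectivity_le_cut[OF conn, of A] A(1) 1 by (simp add: l_def)
    then have "l \<le> 3" using A(2) by linarith
    then show ?thesis using 1 by (simp add: l_def)
  next
    case 2
    define k where "k = (CARD('v) - 2) div 2"
    have k: "1 \<le> k" "k \<le> CARD('v)" using 2 by (auto simp: k_def)
    then obtain A :: "'v set" where A: "card A = k" "cut_size G A \<le> 2" using small_cut[OF k] by blast
    \<comment> \<open>The outer boundary of \<open>A\<close>, to be enlarged to a separator with exactly two vertices.\<close>
    define N where "N = {y. y \<notin> A \<and> (\<exists>x\<in>A. edge_mult G x y > 0)}"
    have "card N = (\<Sum>y\<in>N. 1)" by simp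
    also have "\<dots> \<le> (\<Sum>y\<in>N. \<Sum>x\<in>A. edge_mult G x y)"
    proof (rule sum_mono)
      fix y assume "y \<in> N"
      then obtain x where "x \<in> A" "edge_mult G x y > 0" by (auto simp: N_def)
      then show "1 \<le> (\<Sum>x\<in>A. edge_mult G x y)"
        using member_le_sum[of x A "\<lambda>x. edge_mult G x y"] by simp
    qed
    also have "\<dots> \<le> (\<Sum>y\<in>- A. \<Sum>x\<in>A. edge_mult G x y)"
      by (rule sum_mono2) (auto simp: N_def)
    also have "\<dots> = cut_size G A" unfolding cut_size_def by (rule sum.swap)
    finally have "card N \<le> 2" using A(2) by simp
    have card_compl: "card (- A) = CARD('v) - k" using card_add_card_Compl[of A] A(1) by linarith
    have k2: "2 * k + 2 = CARD('v) \<or> 2 * k + 3 = CARD('v)" using 2 unfolding k_def by presburger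
    then have "2 \<le> card (- A)" using card_compl 2 by linarith
    then obtain S where S: "N \<subseteq> S" "S \<subseteq> - A" "card S = 2"
    proof -
      have "N \<subseteq> - A" by (auto simp: N_def)
      from exists_subset_between[OF \<open>card N \<le> 2\<close> \<open>2 \<le> card (- A)\<close> this] that
      show ?thesis by auto
    qed
    define B where "B = - A - S"
    have "card B = card (- A) - 2"
      unfolding B_def S(3)[symmetric] by (rule card_Diff_subset[OF _ S(2)]) simp
    then have "card B + 2 = card (- A)" using \<open>2 \<le> card (- A)\<close> by simp
    then have B: "card B + card A + 2 = CARD('v)" using card_add_card_Compl[of A] by simp
    have diff: "card B = card A \<or> card B = card A + 1 \<and> CARD('v) \<ge> 5"
      using k2
    proof
      assume "2 * k + 2 = CARD('v)"
      then have "card B = card A" using B A(1) by linarith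
      then show ?thesis ..
    next
      assume odd: "2 * k + 3 = CARD('v)"
      then have "card B = card A + 1" using B A(1) by linarith
      moreover have "CARD('v) \<ge> 5" using odd k(1) by linarith
      ultimately show ?thesis by blast
    qed
    have "l * (real (card A) + real (card B) - (real (card A) - real (card B))\<^sup>2 / n) \<le> 2 * real (card S)"
    proof -
      have "edge_mult G x y = 0" if "x \<in> A" "y \<in> B" for x y
        using that S(1) by (auto simp: B_def N_def)
      moreover have "A \<inter> B = {}" "A \<inter> S = {}" "B \<inter> S = {}" "A \<union> B \<union> S = UNIV"
        using S(2) by (auto simp: B_def)
      ultimately show ?thesis
        using algebraic_connectivity_le_separator[OF conn, of A B S] 2 d by (simp add: l_def n_def)
    qed
    moreover have nab: "real (card A) + real (card B) = n - 2"
      using B by (simp add: n_def flip: of_nat_add)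
    ultimately have bound: "l * (n - 2 - (real (card A) - real (card B))\<^sup>2 / n) \<le> 4"
      using S(3) by simp
    have n4: "n \<ge> 4" using 2 by (simp add: n_def)
    define e where "e = (real (card A) - real (card B))\<^sup>2"
    have "e = 0 \<or> e = 1 \<and> n \<ge> 5" using diff
    proof
      assume "card B = card A"
      then show ?thesis by (simp add: e_def)
    next
      assume BA: "card B = card A + 1 \<and> CARD('v) \<ge> 5"
      then have "real (card A) - real (card B) = -1" by simp
      moreover have "n \<ge> 5" using BA by (simp add: n_def)
      ultimately show ?thesis by (simp add: e_def)
    qed
    then have "(n - 2) * (8 * n + 2) \<le> 9 * n * (n - 2) - 9 * e"
    proof
      assume "e = 0"
      moreover have "(n - 2) * (8 * n + 2) \<le> (n - 2) * (9 * n)"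
        using n4 by (intro mult_left_mono) auto
      ultimately show ?thesis by (simp add: mult.commute)
    next
      assume e: "e = 1 \<and> n \<ge> 5"
      then have "0 \<le> (n - 5) * (n + 1)" by simp
      then show ?thesis using e by (simp add: algebra_simps)
    qed
    also have "\<dots> = 9 * n * (n - 2 - e / n)" using n4 by (simp add: right_diff_distrib)
    finally have "(n - 2) * (8 * n + 2) \<le> 9 * n * (n - 2 - (real (card A) - real (card B))\<^sup>2 / n)"
      unfolding e_def .
    then have "l * ((n - 2) * (8 * n + 2)) \<le> l * (9 * n * (n - 2 - (real (card A) - real (card B))\<^sup>2 / n))"
      using l by (intro mult_left_mono) auto
    also have "\<dots> = 9 * n * (l * (n - 2 - (real (card A) - real (card B))\<^sup>2 / n))"
      by (simp only: mult_ac)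
    also have "\<dots> \<le> 9 * n * 4" using bound n4 by (intro mult_left_mono) auto
    finally show ?thesis by (simp add: l_def n_def mult.assoc)
  qed
qed

section \<open>Connected sets and balanced separations\<close>

text \<open>Connectedness of the induced subgraph, expressed by cuts rather than by paths: every splitting of
  \<open>E\<close> into two nonempty parts is crossed by an edge. This is the form in which it is applied, both
  to sets that a firing splits and to sets that are not connected.\<close>

definition connected_set :: "('v::finite) multigraph \<Rightarrow> 'v set \<Rightarrow> bool" where
  "connected_set G E \<longleftrightarrow> E \<noteq> {} \<and>
     (\<forall>X. E \<inter> X \<noteq> {} \<longrightarrow> E - X \<noteq> {} \<longrightarrow> (\<exists>u\<in>E \<inter> X. \<exists>w\<in>E - X. edge_mult G u w > 0))"

text \<open>Call a subset of \<open>W\<close> closed if no edge joins it to the rest of \<open>W\<close>. A minimal closed set with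
  more than two thirds of the vertices of \<open>W\<close> is too large to be connected, so it splits into two
  smaller closed sets, neither of which has more than two thirds of \<open>W\<close> by minimality. If both had
  less than one third, the union would be too small; so one of them is balanced.\<close>

lemma balanced_split:
  fixes G :: "('v::finite) multigraph"
  assumes "W \<noteq> {}"
    and small: "\<And>E. connected_set G E \<Longrightarrow> E \<subseteq> W \<Longrightarrow> 3 * card E \<le> 2 * card W"
  obtains A where "A \<subseteq> W" "card W \<le> 3 * card A" "3 * card A \<le> 2 * card W"
    and "\<And>u w. u \<in> A \<Longrightarrow> w \<in> W - A \<Longrightarrow> edge_mult G u w = 0"
proof -
  define closed where
    "closed A \<longleftrightarrow> A \<subseteq> W \<and> (\<forall>u\<in>A. \<forall>w\<in>W - A. edge_mult G u w = 0)" for A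
  have "\<exists>A. closed A \<and> card W \<le> 3 * card A \<and> 3 * card A \<le> 2 * card W"
  proof (rule ccontr)
    assume none: "\<not> ?thesis"
    have "card W > 0" using assms(1) by (simp add: card_gt_0_iff)
    then have "closed W \<and> 3 * card W > 2 * card W" by (auto simp: closed_def)
    from ex_has_least_nat[of "\<lambda>C. closed C \<and> 3 * card C > 2 * card W", OF this, of card]
    obtain C where C: "closed C" "3 * card C > 2 * card W"
      and least: "\<And>C'. closed C' \<Longrightarrow> 3 * card C' > 2 * card W \<Longrightarrow> card C \<le> card C'"
      by auto
    have "C \<subseteq> W" using C(1) by (simp add: closed_def)
    have "\<not> connected_set G C" using small[of C] C(2) \<open>C \<subseteq> W\<close> by auto
    moreover have "C \<noteq> {}" using C(2) by auto
    ultimately obtain X where X: "C \<inter> X \<noteq> {}" "C - X \<noteq> {}"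
      and nox: "\<And>u w. u \<in> C \<inter> X \<Longrightarrow> w \<in> C - X \<Longrightarrow> edge_mult G u w = 0"
      unfolding connected_set_def by auto
    have nox': "edge_mult G w u = 0" if "u \<in> C \<inter> X" "w \<in> C - X" for u w
      using nox[OF that] by (simp add: edge_mult_commute)
    have cl: "closed (C \<inter> X)" "closed (C - X)"
      using C(1) nox nox' unfolding closed_def by blast+
    have "card (C \<inter> X) < card C" "card (C - X) < card C"
      using X by (auto intro!: psubset_card_mono)
    then have "3 * card (C \<inter> X) \<le> 2 * card W" "3 * card (C - X) \<le> 2 * card W"
      using least[OF cl(1)] least[OF cl(2)] by linarith+
    then have "3 * card (C \<inter> X) < card W" "3 * card (C - X) < card W"
      using none cl not_less by blast+
    moreover have "card C = card (C \<inter> X) + card (C - X)"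
      using card_Un_disjoint[of "C \<inter> X" "C - X"] by (simp add: Int_Diff_disjoint Int_Diff_Un)
    ultimately show False using C(2) by linarith
  qed
  then show ?thesis using that unfolding closed_def by blast
qed

section \<open>Firing level sets\<close>

text \<open>The change of a divisor when every vertex \<open>v\<close> is fired \<open>f v\<close> times, written as the negative
  Laplacian of \<open>f\<close>. It depends only on differences of values of \<open>f\<close>.\<close>

definition fire :: "('v::finite) multigraph \<Rightarrow> ('v \<Rightarrow> int) \<Rightarrow> 'v divisor" where
  "fire G f w = (\<Sum>v\<in>UNIV. (f v - f w) * int (edge_mult G w v))"

lemma sum_firing_move: "(\<Sum>v\<in>UNIV. f v * firing_move G v w) = fire G f w"
proof -
  have "(\<Sum>v\<in>UNIV. f v * firing_move G v w) =
      f w * firing_move G w w + (\<Sum>v\<in>UNIV - {w}. f v * firing_move G v w)"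
    by (simp add: sum.remove)
  also have "\<dots> = (\<Sum>v\<in>UNIV - {w}. (f v - f w) * int (edge_mult G w v))"
    by (simp add: firing_move_def sum_distrib_left left_diff_distrib sum_subtractf)
  also have "\<dots> = fire G f w"
    by (simp add: fire_def sum.remove[of UNIV w])
  finally show ?thesis .
qed

lemma divisor_equiv_iff_fire: "divisor_equiv G D D' \<longleftrightarrow> (\<exists>f. \<forall>w. D' w = D w + fire G f w)"
  by (simp add: divisor_equiv_def sum_firing_move)

lemma fire_add: "fire G (\<lambda>v. f v + g v) w = fire G f w + fire G g w"
  unfolding fire_def sum.distrib[symmetric] by (intro sum.cong refl) (simp add: algebra_simps)

lemma fire_diff: "fire G (\<lambda>v. f v - g v) w = fire G f w - fire G g w"
  unfolding fire_def sum_subtractf[symmetric] by (intro sum.cong refl) (simp add: algebra_simps)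

lemma fire_const [simp]: "fire G (\<lambda>_. c) w = 0"
  by (simp add: fire_def)

lemma sum_fire: "(\<Sum>w\<in>UNIV. fire G f w) = 0"
proof -
  have "(\<Sum>w\<in>UNIV. fire G f w) = (\<Sum>w\<in>UNIV. \<Sum>v\<in>UNIV. (f w - f v) * int (edge_mult G v w))"
    unfolding fire_def by (rule sum.swap)
  also have "\<dots> = - (\<Sum>w\<in>UNIV. fire G f w)"
    unfolding fire_def sum_negf[symmetric]
    by (intro sum.cong refl) (subst edge_mult_commute, simp add: algebra_simps)
  finally show ?thesis by simp
qed

lemma divisor_degree_fire: "divisor_degree (\<lambda>w. D w + fire G f w) = divisor_degree D"
  by (simp add: divisor_degree_def sum.distrib sum_fire)

lemma divisor_degree_equiv: "divisor_equiv G D D' \<Longrightarrow> divisor_degree D' = divisor_degree D"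
  by (auto simp: divisor_equiv_iff_fire divisor_degree_fire simp flip: fun_eq_iff)

lemma fire_of_bool_outside: "w \<notin> U \<Longrightarrow> fire G (\<lambda>v. of_bool (v \<in> U)) w = (\<Sum>v\<in>U. int (edge_mult G w v))"
  by (simp add: fire_def of_bool_def if_distrib[of "\<lambda>c. c * _"] sum.If_cases cong: if_cong)

text \<open>Firing \<open>U\<close> moves one chip out of \<open>U\<close> along each boundary edge, and all these chips have to be
  there beforehand.\<close>

lemma cut_size_le_degree:
  assumes "effective D" and "effective (\<lambda>w. D w + fire G (\<lambda>v. of_bool (v \<in> U)) w)"
  shows "int (cut_size G U) \<le> divisor_degree D"
proof -
  have "(\<Sum>w\<in>U. fire G (\<lambda>v. of_bool (v \<in> U)) w) = (\<Sum>w\<in>U. \<Sum>v\<in>UNIV. if v \<in> U then 0 else - int (edge_mult G w v))"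
    unfolding fire_def by (intro sum.cong refl) (simp add: of_bool_def)
  also have "\<dots> = - int (cut_size G U)"
    by (simp add: sum.If_cases cut_size_def sum_negf)
  finally have "0 \<le> (\<Sum>w\<in>U. D w) - int (cut_size G U)"
    using sum_nonneg[of U "\<lambda>w. D w + fire G (\<lambda>v. of_bool (v \<in> U)) w"] assms(2)
    by (simp add: effective_def sum.distrib)
  moreover have "(\<Sum>w\<in>U. D w) \<le> divisor_degree D"
    unfolding divisor_degree_def using assms(1) by (intro sum_mono2) (auto simp: effective_def)
  ultimately show ?thesis by linarith
qed

text \<open>Where \<open>f \<le> c\<close> the truncated function is minimal, so chips are only gained. Where \<open>f > c\<close> the
  truncation shrinks the differences to lower neighbours and keeps the other ones, so at least as
  many chips remain as after the full firing of \<open>f\<close>.\<close>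

lemma effective_fire_truncated:
  assumes "effective D" and "effective (\<lambda>w. D w + fire G f w)"
  shows "effective (\<lambda>w. D w + fire G (\<lambda>v. max (f v - c) 0) w)"
  unfolding effective_def
proof
  fix w
  show "0 \<le> D w + fire G (\<lambda>v. max (f v - c) 0) w"
  proof (cases "f w \<le> c")
    case True
    then have "0 \<le> fire G (\<lambda>v. max (f v - c) 0) w"
      unfolding fire_def by (intro sum_nonneg) simp
    then show ?thesis using assms(1) by (simp add: effective_def)
  next
    case False
    then have "fire G f w \<le> fire G (\<lambda>v. max (f v - c) 0) w"
      unfolding fire_def by (intro sum_mono mult_right_mono) auto
    moreover have "0 \<le> D w + fire G f w" using assms(2) by (simp add: effective_def)
    ultimately show ?thesis by linarith
  qed
qed

text \<open>Lowering the threshold by one amounts to firing one more level set. With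
  \<open>effective_fire_truncated\<close>, this connects two equivalent effective divisors by a chain of
  effective divisors in which an increasing sequence of sets is fired.\<close>

lemma fire_truncated_step:
  "fire G (\<lambda>v. max (f v - c) 0) w =
     fire G (\<lambda>v. max (f v - (c + 1)) 0) w + fire G (\<lambda>v. of_bool (v \<in> {v. f v > c})) w"
proof -
  have "(\<lambda>v. max (f v - c) 0) = (\<lambda>v. max (f v - (c + 1)) 0 + of_bool (v \<in> {v. f v > c}))"
    by (auto simp: fun_eq_iff max_def)
  then show ?thesis by (simp only: fire_add)
qed

definition hits :: "'v divisor \<Rightarrow> 'v set \<Rightarrow> bool" where
  "hits D E \<longleftrightarrow> (\<exists>v\<in>E. D v > 0)"

text \<open>Outside \<open>U\<close> no vertex loses chips, so \<open>E\<close> meets \<open>U\<close>. If \<open>E\<close> were not contained in \<open>U\<close>, some edge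
  inside \<open>E\<close> would cross the boundary of \<open>U\<close> and carry a chip to a vertex of \<open>E\<close>.\<close>

lemma fired_set_contains_lost:
  assumes "connected_set G E" and "effective D"
    and "hits D E" and "\<not> hits (\<lambda>w. D w + fire G (\<lambda>v. of_bool (v \<in> U)) w) E"
  shows "E \<subseteq> U"
proof (rule ccontr)
  assume "\<not> E \<subseteq> U"
  then have out: "E - U \<noteq> {}" by auto
  have le0: "D w + (\<Sum>v\<in>U. int (edge_mult G w v)) \<le> 0" if "w \<in> E - U" for w
  proof -
    have "\<not> D w + fire G (\<lambda>v. of_bool (v \<in> U)) w > 0"
      using assms(4) that by (simp add: hits_def)
    then show ?thesis using that by (simp add: fire_of_bool_outside del: of_nat_sum)
  qed
  have D0: "D w \<ge> 0" for w using assms(2) by (simp add: effective_def)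
  show False
  proof (cases "E \<inter> U = {}")
    case True
    obtain v where v: "v \<in> E" "D v > 0" using assms(3) by (auto simp: hits_def)
    moreover have "(\<Sum>x\<in>U. int (edge_mult G v x)) \<ge> 0" by (intro sum_nonneg) simp
    moreover have "v \<in> E - U" using v(1) True by blast
    ultimately show False using le0[of v] by linarith
  next
    case False
    then obtain u w where uw: "u \<in> E \<inter> U" "w \<in> E - U" "edge_mult G u w > 0"
      using assms(1) out unfolding connected_set_def by blast
    then have "edge_mult G w u > 0" by (simp add: edge_mult_commute)
    then have "(\<Sum>x\<in>U. int (edge_mult G w x)) > 0" using uw
      by (intro sum_pos2[of U u]) auto
    then show False using le0[OF uw(2)] D0[of w] by linarith
  qed
qed

text \<open>Firing \<open>U\<close> is undone by firing its complement, and then \<open>E\<close> is lost.\<close>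

lemma fired_set_avoids_gained:
  assumes "connected_set G E" and "effective (\<lambda>w. D w + fire G (\<lambda>v. of_bool (v \<in> U)) w)"
    and "\<not> hits D E" and "hits (\<lambda>w. D w + fire G (\<lambda>v. of_bool (v \<in> U)) w) E"
  shows "E \<inter> U = {}"
proof -
  have "(\<lambda>v. of_bool (v \<in> - U) :: int) = (\<lambda>v. 1 - of_bool (v \<in> U))" by (auto simp: fun_eq_iff)
  then have "fire G (\<lambda>v. of_bool (v \<in> - U)) w = - fire G (\<lambda>v. of_bool (v \<in> U)) w" for w
    by (simp only: fire_diff fire_const)
  then have "E \<subseteq> - U"
    using assms by (intro fired_set_contains_lost[OF assms(1,2)]) simp_all
  then show ?thesis by auto
qed

lemma degree_ge_1_if_positive_rank:
  assumes "positive_rank G D"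
  shows "divisor_degree D \<ge> 1"
proof -
  fix v
  obtain E where E: "effective E" "divisor_equiv G (\<lambda>w. D w - (if w = v then 1 else 0)) E"
    using assms unfolding positive_rank_def by blast
  have "divisor_degree E = divisor_degree D - 1"
    unfolding divisor_degree_equiv[OF E(2)] by (simp add: divisor_degree_def sum_subtractf)
  moreover have "divisor_degree E \<ge> 0"
    using E(1) by (simp add: divisor_degree_def effective_def sum_nonneg)
  ultimately show ?thesis by simp
qed

text \<open>Degrees of divisors of positive rank are bounded below, and the divisor with one chip on each
  vertex shows that there are any; so the least degree over the integers is a minimum.\<close>

lemma gonality_attained:
  obtains D where "positive_rank G D" and "divisor_degree D = gonality G"
proof -
  have "positive_rank G (\<lambda>_. 1)"
    unfolding positive_rank_def
  proof
    fix v
    show "\<exists>E. effective E \<and> divisor_equiv G (\<lambda>w. 1 - (if w = v then 1 else 0)) E"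
    proof (rule exI, rule conjI)
      show "divisor_equiv G (\<lambda>w. 1 - (if w = v then 1 else 0)) (\<lambda>w. 1 - (if w = v then 1 else 0))"
        unfolding divisor_equiv_iff_fire by (rule exI[of _ "\<lambda>_. 0"]) simp
    qed (simp add: effective_def)
  qed
  from ex_has_least_nat[of "positive_rank G", OF this, of "\<lambda>D. nat (divisor_degree D)"]
  obtain D where D: "positive_rank G D"
    and least: "\<forall>D'. positive_rank G D' \<longrightarrow> nat (divisor_degree D) \<le> nat (divisor_degree D')"
    by (elim exE conjE)
  have "gonality G = divisor_degree D"
    unfolding gonality_def
  proof (rule Least_equality)
    fix k assume "\<exists>D'. positive_rank G D' \<and> divisor_degree D' = k"
    then obtain D' where D': "positive_rank G D'" "divisor_degree D' = k" by blast
    show "divisor_degree D \<le> k"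
      using least[rule_format, OF D'(1)] degree_ge_1_if_positive_rank[OF D'(1)] D'(2) by linarith
  qed (rule exI[of _ D], simp add: D)
  from that[OF D this[symmetric]] show ?thesis .
qed

section \<open>Scrambles\<close>

text \<open>Among the effective divisors equivalent to \<open>D\<close> let \<open>D0\<close> hit as many of the sets in \<open>\<E>\<close> as
  possible, and let \<open>E\<close> be one that it misses. Positive rank gives an equivalent effective divisor
  that hits \<open>E\<close>; walk towards it by firing an increasing sequence of level sets, until \<open>E\<close> is
  first hit. The last fired set avoids \<open>E\<close>, and hence all earlier ones do. By the choice of \<open>D0\<close>
  some \<open>E'\<close> that \<open>D0\<close> hits has been lost on the way, and the set \<open>U\<close> whose firing lost it
  contains \<open>E'\<close>.\<close>

lemma scramble_cut:
  fixes G :: "('v::finite) multigraph"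
  assumes rank: "positive_rank G D"
    and conn: "\<And>E. E \<in> \<E> \<Longrightarrow> connected_set G E"
    and miss: "\<And>D'. effective D' \<Longrightarrow> divisor_degree D' = divisor_degree D \<Longrightarrow> \<exists>E\<in>\<E>. \<not> hits D' E"
  obtains U E E' where "E \<in> \<E>" "E' \<in> \<E>" "E' \<subseteq> U" "E \<inter> U = {}" "int (cut_size G U) \<le> divisor_degree D"
proof -
  define C where "C D' \<longleftrightarrow> effective D' \<and> divisor_equiv G D D'" for D'
  have through: "\<exists>D'. C D' \<and> D' v > 0" for v
  proof -
    obtain F where F: "effective F" "divisor_equiv G (\<lambda>w. D w - (if w = v then 1 else 0)) F"
      using rank[unfolded positive_rank_def, rule_format, of v] by (elim exE conjE)
    from F(2) obtain f where "\<forall>w. F w = D w - (if w = v then 1 else 0) + fire G f w"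
      unfolding divisor_equiv_iff_fire by (elim exE)
    then have f: "D w + fire G f w = F w + (if w = v then 1 else 0)" for w by simp
    have F0: "F w \<ge> 0" for w using F(1) by (simp add: effective_def)
    have "effective (\<lambda>w. D w + fire G f w)"
      unfolding effective_def f using F0 by (simp add: add_nonneg_nonneg)
    moreover have "divisor_equiv G D (\<lambda>w. D w + fire G f w)"
      unfolding divisor_equiv_iff_fire by (rule exI[of _ f]) simp
    ultimately have "C (\<lambda>w. D w + fire G f w)" by (simp add: C_def)
    moreover have "D v + fire G f v > 0" unfolding f using F0[of v] by simp
    ultimately show ?thesis by blast
  qed
  obtain D0 where D0: "C D0"
    and max: "\<forall>D'. C D' \<longrightarrow> card {E\<in>\<E>. hits D' E} \<le> card {E\<in>\<E>. hits D0 E}"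
  proof -
    obtain D1 where D1: "C D1" using through by blast
    have "\<forall>D'. C D' \<longrightarrow> card {E\<in>\<E>. hits D' E} < Suc (card \<E>)"
      by (intro allI impI le_imp_less_Suc card_mono) auto
    with D1 have "\<exists>D0. C D0 \<and> (\<forall>D'. C D' \<longrightarrow> card {E\<in>\<E>. hits D' E} \<le> card {E\<in>\<E>. hits D0 E})"
      by (rule ex_has_greatest_nat)
    then show ?thesis by (elim exE conjE) (rule that)
  qed
  have deg: "divisor_degree D' = divisor_degree D" if "C D'" for D'
    by (rule divisor_degree_equiv[of G]) (use that in \<open>simp add: C_def\<close>)
  obtain E where E: "E \<in> \<E>" "\<not> hits D0 E"
    using miss[OF _ deg[OF D0]] D0 by (auto simp: C_def)
  obtain v where "v \<in> E" using conn[OF E(1)] by (auto simp: connected_set_def)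
  obtain D1 where D1: "C D1" "D1 v > 0" using through by blast
  obtain f0 f1 where f0: "\<And>w. D0 w = D w + fire G f0 w" and f1: "\<And>w. D1 w = D w + fire G f1 w"
    using D0 D1(1) unfolding C_def divisor_equiv_iff_fire by auto
  define f where "f v = f1 v - f0 v" for v
  have f: "D1 = (\<lambda>w. D0 w + fire G f w)"
    unfolding f_def fire_diff by (simp add: fun_eq_iff f0 f1)
  define M where "M = Max (range f)"
  have f_le: "f v \<le> M" for v by (simp add: M_def)
  \<comment> \<open>\<open>H j\<close> is reached from \<open>D0\<close> by firing \<open>U 1, ..., U j\<close>, the first \<open>j\<close> superlevel sets of \<open>f\<close>.\<close>
  define H where "H j = (\<lambda>w. D0 w + fire G (\<lambda>v. max (f v - (M - int j)) 0) w)" for j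
  define U where "U j = {v. f v > M - int j}" for j
  have H_eff: "effective (H j)" for j
    unfolding H_def using D0 D1(1) f by (intro effective_fire_truncated) (auto simp: C_def)
  have H_equiv: "divisor_equiv G D (H j)" for j
    unfolding divisor_equiv_iff_fire
    by (rule exI[of _ "\<lambda>v. f0 v + max (f v - (M - int j)) 0"]) (simp add: H_def f0 fire_add)
  have CH: "C (H j)" for j using H_eff H_equiv by (simp add: C_def)
  have H_Suc: "H (Suc j) = (\<lambda>w. H j w + fire G (\<lambda>v. of_bool (v \<in> U (Suc j))) w)" for j
    unfolding H_def U_def using fire_truncated_step[of G f "M - int (Suc j)"] by (simp add: fun_eq_iff)
  have H_0: "H 0 = D0"
  proof -
    have "(\<lambda>v. max (f v - (M - int 0)) 0) = (\<lambda>v. 0)" using f_le by (auto simp: fun_eq_iff)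
    then show ?thesis by (simp only: H_def fire_const add_0_right)
  qed
  obtain N where N: "H N = D1"
  proof
    define m where "m = Min (range f)"
    have f_ge: "m \<le> f v" for v by (simp add: m_def)
    have "m \<le> M" using f_ge f_le order_trans by blast
    then have "(\<lambda>v. max (f v - (M - int (nat (M - m)))) 0) = (\<lambda>v. f v - m)"
      using f_ge by (auto simp: fun_eq_iff)
    then show "H (nat (M - m)) = D1" by (simp only: H_def f fire_diff fire_const diff_zero)
  qed
  have "hits (H N) E" using N D1(2) \<open>v \<in> E\<close> by (auto simp: hits_def)
  moreover have "\<not> hits (H 0) E" using E(2) H_0 by simp
  ultimately obtain k where k: "hits (H (Suc k)) E" "\<not> hits (H k) E"
    using ex_least_nat_less[of "\<lambda>j. hits (H j) E" N] by auto
  have disj: "E \<inter> U (Suc k) = {}"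
    using k H_eff[of "Suc k"] unfolding H_Suc by (intro fired_set_avoids_gained[OF conn[OF E(1)]])
  have "\<exists>E'\<in>\<E>. hits D0 E' \<and> \<not> hits (H (Suc k)) E'"
  proof (rule ccontr)
    assume "\<not> ?thesis"
    then have "{E\<in>\<E>. hits D0 E} \<subset> {E\<in>\<E>. hits (H (Suc k)) E}" using E k(1) by auto
    then have "card {E\<in>\<E>. hits D0 E} < card {E\<in>\<E>. hits (H (Suc k)) E}"
      by (rule psubset_card_mono[rotated]) simp
    then show False using max[rule_format, OF CH[of "Suc k"]] by simp
  qed
  then obtain E' where E': "E' \<in> \<E>" "hits (H 0) E'" "\<not> hits (H (Suc k)) E'" using H_0 by auto
  then obtain i where i: "i < Suc k" "\<not> hits (H (Suc i)) E'" "hits (H i) E'"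
    using ex_least_nat_less[of "\<lambda>j. \<not> hits (H j) E'" "Suc k"] by auto
  have "E' \<subseteq> U (Suc i)"
    using i(2,3) H_eff[of i] unfolding H_Suc by (intro fired_set_contains_lost[OF conn[OF E'(1)]])
  moreover have "U (Suc i) \<subseteq> U (Suc k)" using i(1) by (auto simp: U_def)
  moreover have "int (cut_size G (U (Suc i))) \<le> divisor_degree D"
    using cut_size_le_degree[OF H_eff[of i], of G "U (Suc i)"] H_eff[of "Suc i"] deg[OF CH[of i]] by (simp add: H_Suc)
  ultimately show ?thesis using that E(1) E'(1) disj by blast
qed

section \<open>The gonality bound\<close>

text \<open>The bound as a quadratic inequality for \<open>g\<close>. Its negation forbids balanced separations by \<open>g\<close> vertices, so
  that the scramble of connected sets with more than \<open>2 (n - g) / 3\<close> vertices has no hitting set of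
  that size; what remains is to show that a cut with at most \<open>g\<close> edges cannot separate two of its
  sets either.\<close>

lemma positive_rank_degree_bound:
  fixes G :: "('v::finite) multigraph" and D :: "'v divisor"
  defines "l \<equiv> algebraic_connectivity G" and "n \<equiv> real CARD('v)" and "g \<equiv> real_of_int (divisor_degree D)"
  assumes conn: "connected_multigraph G" and n2: "CARD('v) \<ge> 2"
    and not_K2: "\<not> (CARD('v) = 2 \<and> size G = 1)"
    and rank: "positive_rank G D" and l: "l > 0"
  shows "l * (n - g) * (8 * n + g) \<le> 9 * n * real (max_valence G) * g"
proof (rule ccontr)
  define d where "d = real (max_valence G)"
  assume "\<not> ?thesis"
  then have small: "9 * n * d * g < l * (n - g) * (8 * n + g)" unfolding d_def by (rule not_le_imp_less)
  have n: "n \<ge> 2" using n2 by (simp add: n_def)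
  have d2: "max_valence G \<ge> 2" using max_valence_ge_2[OF conn n2 not_K2] .
  have g1: "divisor_degree D \<ge> 1" by (rule degree_ge_1_if_positive_rank[OF rank])
  define k where "k = nat (divisor_degree D)"
  have k: "divisor_degree D = int k" "g = real k" "k \<ge> 1" using g1 by (simp_all add: k_def g_def)
  have "0 < l * (n - g) * (8 * n + g)"
    using small n k by (smt (verit) d_def mult_nonneg_nonneg of_nat_0_le_iff)
  then have "g < n" using l n k by (simp add: zero_less_mult_iff)
  then have kn: "k < CARD('v)" by (simp add: k n_def)
  define \<E> where "\<E> = {E. connected_set G E \<and> 3 * card E > 2 * (CARD('v) - k)}"
  have miss: "\<exists>E\<in>\<E>. \<not> hits D' E" if D': "effective D'" "divisor_degree D' = divisor_degree D" for D'
  proof (rule ccontr)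
    assume all_hit: "\<not> ?thesis"
    define T where "T = {v. D' v > 0}"
    \<comment> \<open>The support of \<open>D'\<close> has at most \<open>g\<close> elements; it is enlarged to a set of exactly \<open>g\<close>.\<close>
    have "int (card T) = (\<Sum>v\<in>T. 1)" by simp
    also have "\<dots> \<le> (\<Sum>v\<in>T. D' v)" by (rule sum_mono) (simp add: T_def)
    also have "\<dots> \<le> divisor_degree D'"
      unfolding divisor_degree_def using D'(1) by (intro sum_mono2) (auto simp: effective_def)
    finally have "card T \<le> k" using D'(2) k(1) by simp
    then obtain S where S: "T \<subseteq> S" "card S = k"
      using exists_subset_between[of T k "UNIV :: 'v set"] kn by auto
    have cardW: "card (- S) = CARD('v) - k" using card_add_card_Compl[of S] S(2) by linarith
    have nonempty: "- S \<noteq> {}"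
    proof
      assume "- S = {}"
      then have "card (- S) = 0" by (simp only: card.empty)
      then show False using cardW kn by linarith
    qed
    have no_egg: "3 * card E \<le> 2 * card (- S)" if E: "connected_set G E" "E \<subseteq> - S" for E
    proof (rule ccontr)
      assume "\<not> ?thesis"
      then have "E \<in> \<E>" using E(1) cardW by (simp add: \<E>_def)
      then have "hits D' E" using all_hit by blast
      then show False using E(2) S(1) by (auto simp: hits_def T_def)
    qed
    obtain A where A: "A \<subseteq> - S" "card (- S) \<le> 3 * card A" "3 * card A \<le> 2 * card (- S)"
      and sep: "\<And>u w. u \<in> A \<Longrightarrow> w \<in> - S - A \<Longrightarrow> edge_mult G u w = 0"
      using balanced_split[OF nonempty no_egg] by blast
    define B where "B = - S - A"
    define m where "m = n - g"
    define a b where "a = real (card A)" and "b = real (card B)"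
    have m: "real (card (- S)) = m" using cardW kn k by (simp add: m_def n_def of_nat_diff)
    have "card B = card (- S) - card A" using A(1) by (simp add: B_def card_Diff_subset)
    moreover have "card A \<le> card (- S)" using A(1) by (simp add: card_mono)
    ultimately have ab: "a + b = m" using m by (simp add: a_def b_def of_nat_diff)
    have a: "m \<le> 3 * a" "3 * a \<le> 2 * m" using A(2,3) m by (simp_all add: a_def)
    have "l * (a + b - (a - b)\<^sup>2 / n) \<le> d * real (card S)"
      unfolding a_def b_def l_def n_def d_def
      by (rule algebraic_connectivity_le_separator[OF conn n2]) (use A(1) sep in \<open>auto simp: B_def\<close>)
    moreover have "m - m\<^sup>2 / (9 * n) \<le> a + b - (a - b)\<^sup>2 / n"
    proof -
      have "3 * (a - b) \<le> m" "- m \<le> 3 * (a - b)" using a ab by argo+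
      then have "\<bar>3 * (a - b)\<bar> \<le> m" by (intro abs_leI) (simp_all only: minus_le_iff)
      then have "\<bar>3 * (a - b)\<bar>\<^sup>2 \<le> m\<^sup>2" by (intro power_mono) auto
      then have "9 * (a - b)\<^sup>2 \<le> m\<^sup>2" by (simp only: power2_abs power_mult_distrib) simp
      then have "(a - b)\<^sup>2 / n \<le> m\<^sup>2 / (9 * n)" using n by (simp add: field_simps)
      then show ?thesis using ab by simp
    qed
    ultimately have "l * (m - m\<^sup>2 / (9 * n)) \<le> d * g"
      using l S(2) k(2) by (smt (verit) mult_left_mono)
    then have "9 * n * (l * (m - m\<^sup>2 / (9 * n))) \<le> 9 * n * (d * g)"
      using n by (intro mult_left_mono) auto
    moreover have "9 * n * (l * (m - m\<^sup>2 / (9 * n))) = l * m * (9 * n - m)"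
      using n by (simp add: field_simps power2_eq_square)
    ultimately show False using small by (simp add: m_def algebra_simps)
  qed
  obtain U E E' where UE: "E \<in> \<E>" "E' \<in> \<E>" "E' \<subseteq> U" "E \<inter> U = {}" "int (cut_size G U) \<le> divisor_degree D"
    by (rule scramble_cut[OF rank _ miss]) (auto simp: \<E>_def)
  define p q where "p = card U" and "q = card (- U)"
  have pq: "p + q = CARD('v)" unfolding p_def q_def by (rule card_add_card_Compl)
  have "card E' \<le> p" "card E \<le> q" unfolding p_def q_def using UE(3,4) by (auto intro!: card_mono)
  then have p: "3 * p > 2 * (CARD('v) - k)" and q: "3 * q > 2 * (CARD('v) - k)"
    using UE(1,2) by (auto simp: \<E>_def)
  have cut: "l * real p * real q \<le> n * g"
  proof -
    have "l * real p * real q \<le> n * real (cut_size G U)"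
      using algebraic_connectivity_le_cut[OF conn n2, of U] by (simp add: l_def n_def p_def q_def)
    also have "\<dots> \<le> n * g" using UE(5) k n by (intro mult_left_mono) auto
    finally show ?thesis .
  qed
  have pr: "3 * real p - 2 * (n - g) \<ge> 0" and qr: "3 * real q - 2 * (n - g) \<ge> 0"
    using p q kn by (simp_all add: n_def k of_nat_diff)
  have pqr: "real p + real q = n" using pq by (simp add: n_def flip: of_nat_add)
  \<comment> \<open>The two sides of the cut each have more than \<open>2 (n - g) / 3\<close> of the \<open>n\<close> vertices.\<close>
  have quarter: "4 * g > n" using p q pq kn by (simp add: n_def k)
  \<comment> \<open>With both parts of size at least \<open>2 (n - g) / 3\<close>, the product \<open>p q\<close> is at least
    \<open>2 (n - g) (n + 2 g) / 9\<close>, its value when one part is as small as allowed. Comparing the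
    resulting lower bound for \<open>g\<close> with the upper bound given by \<open>small\<close> eliminates \<open>\<lambda>\<close>.\<close>
  have "2 * d * (n + 2 * g) < 8 * n + g"
  proof -
    have "0 \<le> (3 * real p - 2 * (n - g)) * (3 * real q - 2 * (n - g))" using pr qr by (rule mult_nonneg_nonneg)
    also have "\<dots> = 9 * (real p * real q) - 6 * (n - g) * (real p + real q) + 4 * (n - g)\<^sup>2"
      by (simp add: algebra_simps power2_eq_square)
    also have "\<dots> = 9 * (real p * real q) - 2 * (n - g) * (n + 2 * g)"
      unfolding pqr by (simp add: algebra_simps power2_eq_square)
    finally have "l * (2 * (n - g) * (n + 2 * g)) \<le> l * (9 * (real p * real q))"
      using l by (intro mult_left_mono) auto
    also have "\<dots> \<le> 9 * n * g" using cut by simp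
    finally have "d * (l * (2 * (n - g) * (n + 2 * g))) \<le> d * (9 * n * g)"
      by (rule mult_left_mono) (simp add: d_def)
    also have "\<dots> < l * (n - g) * (8 * n + g)" using small by (simp add: mult_ac)
    finally have "(l * (n - g)) * (2 * d * (n + 2 * g)) < (l * (n - g)) * (8 * n + g)"
      by (simp only: mult_ac)
    moreover have "l * (n - g) > 0" using l \<open>g < n\<close> by simp
    ultimately show ?thesis by (simp only: mult_less_cancel_left_pos)
  qed
  moreover have "d \<le> 2"
  proof (rule ccontr)
    assume "\<not> d \<le> 2"
    then have "max_valence G \<ge> 3" by (simp add: d_def)
    then have "d \<ge> 3" by (simp add: d_def)
    then have "2 * 3 * (n + 2 * g) \<le> 2 * d * (n + 2 * g)"
      using n k by (intro mult_right_mono) auto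
    then have "2 * 3 * (n + 2 * g) < 8 * n + g"
      using \<open>2 * d * (n + 2 * g) < 8 * n + g\<close> by (rule le_less_trans)
    then show False using quarter n by argo
  qed
  ultimately have d: "d = 2" using d2 by (simp add: d_def)
  show False
  proof (cases "k = 1")
    case True
    \<comment> \<open>Here the integrality of \<open>p\<close> and \<open>q\<close> is essential: \<open>3 p > 2 (n - 1)\<close> and
      \<open>3 q > 2 (n - 1)\<close> force \<open>n = 2\<close>.\<close>
    then have "CARD('v) = 2" "p = 1" "q = 1" using p q pq n2 by linarith+
    then have "l \<le> 2" using cut True k(2) by (simp add: n_def)
    then show False using small d True k(2) \<open>CARD('v) = 2\<close> by (simp add: n_def)
  next
    case False
    then have g2: "g \<ge> 2" and "CARD('v) \<ge> 3" using k kn by auto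
    \<comment> \<open>The assumed inequality becomes weaker as \<open>g\<close> decreases, and it already fails for \<open>g = 2\<close>.\<close>
    then have "l * ((n - 2) * (8 * n + 2)) \<le> 36 * n"
      using algebraic_connectivity_le_if_max_valence_2[OF conn] d l by (simp add: l_def n_def d_def mult.assoc)
    also have "\<dots> \<le> 9 * n * d * g" using d g2 n by simp
    also have "\<dots> < l * ((n - g) * (8 * n + g))" using small by (simp add: mult.assoc)
    also have "\<dots> \<le> l * ((n - 2) * (8 * n + 2))"
    proof (rule mult_left_mono)
      have "0 \<le> (g - 2) * (7 * n + g + 2)" using g2 n by (intro mult_nonneg_nonneg) auto
      then show "(n - g) * (8 * n + g) \<le> (n - 2) * (8 * n + 2)"
        by (simp add: algebra_simps)
    qed (use l in simp)
    finally show False by simp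
  qed
qed

theorem theorem1p4:
  fixes G :: "('v::finite) multigraph" and d l :: real
  assumes "connected_multigraph G"
    and "CARD('v) \<ge> 2"
    and "\<not> (CARD('v) = 2 \<and> size G = 1)"
    and "d = real (max_valence G)"
    and "l = algebraic_connectivity G"
  shows "real_of_int (gonality G) \<ge>
    real CARD('v) / (2 * l) *
      (- (7 * l + 9 * d) + 3 * sqrt (9 * l\<^sup>2 + 14 * d * l + 9 * d\<^sup>2))"
proof -
  define n where "n = real CARD('v)"
  define R where "R = 9 * l\<^sup>2 + 14 * d * l + 9 * d\<^sup>2"
  have n: "n > 0" by (simp add: n_def)
  have d: "d \<ge> 0" by (simp add: assms(4))
  obtain D where D: "positive_rank G D" "divisor_degree D = gonality G" by (rule gonality_attained)
  define g where "g = real_of_int (gonality G)"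
  have g: "g \<ge> 1" using degree_ge_1_if_positive_rank[OF D(1)] D(2) by (simp add: g_def)
  \<comment> \<open>Up to the factor \<open>n\<^sup>2\<close>, \<open>9 * R\<close> is the discriminant of
    \<open>l * x\<^sup>2 + n * (7 * l + 9 * d) * x - 8 * l * n\<^sup>2 = 0\<close>, which is the equation
    \<open>9 * n * d * x = l * (n - x) * (8 * n + x)\<close>.\<close>
  have R: "9 * R = (7 * l + 9 * d)\<^sup>2 + 32 * l\<^sup>2"
    by (simp add: R_def power2_eq_square algebra_simps)
  have sqrt_R: "3 * sqrt R = sqrt (9 * R)" by (simp add: real_sqrt_mult)
  have "n / (2 * l) * (- (7 * l + 9 * d) + 3 * sqrt R) \<le> g"
  proof (cases "l > 0")
    case False
    \<comment> \<open>In this case the right-hand side of the claim is nonpositive, also by \<open>x / 0 = 0\<close> for \<open>l = 0\<close>.\<close>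
    have "7 * l + 9 * d \<le> sqrt (9 * R)" unfolding R by (rule real_le_rsqrt) simp
    then have "0 \<le> - (7 * l + 9 * d) + 3 * sqrt R" unfolding sqrt_R by simp
    moreover have "n / (2 * l) \<le> 0" using False n by (simp add: divide_nonneg_nonpos)
    ultimately have "n / (2 * l) * (- (7 * l + 9 * d) + 3 * sqrt R) \<le> 0"
      by (rule mult_nonpos_nonneg[rotated])
    then show ?thesis using g by simp
  next
    case True
    have "l * (n - g) * (8 * n + g) \<le> 9 * n * d * g"
      using positive_rank_degree_bound[OF assms(1-3) D(1)] True assms(4,5) D(2)
      by (simp add: n_def g_def)
    then have "4 * l * (l * (n - g) * (8 * n + g)) \<le> 4 * l * (9 * n * d * g)"
      using True by (intro mult_left_mono) auto
    then have "32 * l\<^sup>2 * n\<^sup>2 \<le> 4 * l * (l * g\<^sup>2 + n * g * (7 * l + 9 * d))"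
      by (simp add: power2_eq_square algebra_simps)
    then have "n\<^sup>2 * (9 * R) \<le> (2 * l * g + n * (7 * l + 9 * d))\<^sup>2"
      unfolding R by (simp add: power2_eq_square algebra_simps)
    then have "sqrt (n\<^sup>2 * (9 * R)) \<le> 2 * l * g + n * (7 * l + 9 * d)"
      using True n g d by (intro real_le_lsqrt) auto
    then have "n * (3 * sqrt R) \<le> 2 * l * g + n * (7 * l + 9 * d)"
      unfolding sqrt_R using n by (simp only: real_sqrt_mult real_sqrt_abs abs_of_pos)
    then show ?thesis using True by (simp add: field_simps)
  qed
  then show ?thesis by (simp add: n_def R_def g_def)
qed

end
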